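(* Let $p\in(1,2]$, let $N,P\ge 2$ be integers, let $f_0,f_1\in\mathbb R^N$ be vectors with nonnegative entries, and fix either mirror or periodic boundary conditions. Let the matrices $S_{\rm m},S_{\rm f},D_{\rm m},D_{\rm f}$, the vectors $f^+,f^-$, the number $\kappa$, the function $J_p$ and the set $\mathcal C$ be as defined in the context. Then both of the following minimization problems over $(m,f)\in\mathbb R^{(N-\kappa)P}\times\mathbb R^{N(P-1)}$ have a solution (a global minimizer): (a) (constrained transport problem) $$\min_{(m,f)}\ \|J_p(S_{\rm m}m,\,S_{\rm f}f+f^+)\|_1+\iota_{\mathcal C}(m,f);$$ (b) (penalized transport problem), for every $\lambda>0$, $$\min_{(m,f)}\ \|J_p(S_{\rm m}m,\,S_{\rm f}f+f^+)\|_1+\lambda\Big\|(D_{\rm m}\,|\,D_{\rm f})\begin{pmatrix}m\\ f\end{pmatrix}-f^-\Big\|_2^2 .$$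
   Context: For $n\ge2$ define $D_n\in\mathbb R^{n-1,n}$ by $(D_nx)_j=n(x_{j+1}-x_j)$, $j=1,\dots,n-1$; $D_n^{\rm per}\in\mathbb R^{n,n}$ by $(D_n^{\rm per}x)_1=n(x_1-x_n)$ and $(D_n^{\rm per}x)_j=n(x_j-x_{j-1})$, $j=2,\dots,n$; $S_n\in\mathbb R^{n-1,n}$ by $(S_nx)_j=\frac12(x_j+x_{j+1})$, $j=1,\dots,n-1$; $S_n^{\rm per}\in\mathbb R^{n,n}$ by $(S_n^{\rm per}x)_1=\frac12(x_1+x_n)$ and $(S_n^{\rm per}x)_j=\frac12(x_{j-1}+x_j)$, $j=2,\dots,n$. Let $I_n$ be the $n\times n$ identity matrix and $\otimes$ the Kronecker product, $A\otimes B=(a_{ij}B)_{i,j}$. Set $S_{\rm f}:=S_P^{T}\otimes I_N$ and $D_{\rm f}:=D_P^{T}\otimes I_N$. For mirror boundary conditions set $\kappa:=1$, $S_{\rm m}:=I_P\otimes S_N^{T}$, $D_{\rm m}:=I_P\otimes D_N^{T}$. For periodic boundary conditions set $\kappa:=0$, $S_{\rm m}:=I_P\otimes (S_N^{\rm per})^{T}$, $D_{\rm m}:=I_P\otimes (D_N^{\rm per})^{T}$. Thus the variables are $m\in\mathbb R^{(N-\kappa)P}$ and $f\in\mathbb R^{N(P-1)}$, and $S_{\rm m}m$, $S_{\rm f}f$, $D_{\rm m}m$, $D_{\rm f}f\in\mathbb R^{NP}$. Set $$f^+:=\tfrac12(f_0^{T},0,f_1^{T})^{T}\in\mathbb R^{NP},\qquad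 f^-:=P(-f_0^{T},0,f_1^{T})^{T}\in\mathbb R^{NP},$$ where $0$ is the zero row vector of length $N(P-2)$. The function $J_p:\mathbb R\times\mathbb R\to\mathbb R\cup\{+\infty\}$ is $J_p(x,y)=\frac1p\frac{|x|^p}{y^{p-1}}$ if $y>0$, $J_p(0,0)=0$, and $J_p(x,y)=+\infty$ otherwise. For vectors $u,v\in\mathbb R^{NP}$, $J_p(u,v)$ is applied componentwise and $\|J_p(u,v)\|_1$ is the sum of its (nonnegative, possibly infinite) components. $\mathcal C$ is the set of all minimizers $(m,f)\in\mathbb R^{(N-\kappa)P}\times\mathbb R^{N(P-1)}$ of $\big\|(D_{\rm m}|D_{\rm f})\binom{m}{f}-f^-\big\|_2^2$, and $\iota_{\mathcal C}$ is its indicator function ($0$ on $\mathcal C$, $+\infty$ outside). *)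

theory Defs
  imports "HOL-Analysis.Analysis" "Jordan_Normal_Form.Matrix"
begin

(* Vectors and matrices are those of Jordan_Normal_Form, so $ is vec_index, not vec_nth. *)
unbundle no vec_syntax

section \<open>Difference and averaging matrices\<close>

text \<open>Indices are 0-based throughout: entry \<open>i\<close> here is entry \<open>i + 1\<close> in 1-based notation.\<close>

definition diff_mat :: "nat \<Rightarrow> real mat" where
  "diff_mat n = mat (n - 1) n (\<lambda>(i, j). real n * (of_bool (j = i + 1) - of_bool (j = i)))"

definition cyc_pred :: "nat \<Rightarrow> nat \<Rightarrow> nat" where
  "cyc_pred n i = (if i = 0 then n - 1 else i - 1)"

definition diff_per_mat :: "nat \<Rightarrow> real mat" where
  "diff_per_mat n = mat n n (\<lambda>(i, j). real n * (of_bool (j = i) - of_bool (j = cyc_pred n i)))"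

definition avg_mat :: "nat \<Rightarrow> real mat" where
  "avg_mat n = mat (n - 1) n (\<lambda>(i, j). 1 / 2 * (of_bool (j = i) + of_bool (j = i + 1)))"

definition avg_per_mat :: "nat \<Rightarrow> real mat" where
  "avg_per_mat n = mat n n (\<lambda>(i, j). 1 / 2 * (of_bool (j = cyc_pred n i) + of_bool (j = i)))"

lemma sum_of_bool_times:
  fixes x :: "nat \<Rightarrow> real"
  assumes "k < n"
  shows "(\<Sum>j = 0..<n. of_bool (j = k) * x j) = x k"
  using assms by (subst sum.remove[of _ k]) auto

lemma diff_mat_mult_vec:
  assumes "x \<in> carrier_vec n" "i < n - 1"
  shows "(diff_mat n *\<^sub>v x) $ i = real n * (x $ (i + 1) - x $ i)"
proof -
  have "(diff_mat n *\<^sub>v x) $ i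
      = (\<Sum>j = 0..<n. real n * (of_bool (j = i + 1) * x $ j - of_bool (j = i) * x $ j))"
    using assms by (auto simp: diff_mat_def scalar_prod_def algebra_simps intro!: sum.cong)
  then show ?thesis
    using assms by (simp add: sum_of_bool_times sum_subtractf flip: sum_distrib_left)
qed

lemma diff_per_mat_mult_vec:
  assumes "x \<in> carrier_vec n" "i < n"
  shows "(diff_per_mat n *\<^sub>v x) $ i = real n * (x $ i - x $ (if i = 0 then n - 1 else i - 1))"
proof -
  have "(diff_per_mat n *\<^sub>v x) $ i
      = (\<Sum>j = 0..<n. real n * (of_bool (j = i) * x $ j - of_bool (j = cyc_pred n i) * x $ j))"
    using assms by (auto simp: diff_per_mat_def scalar_prod_def algebra_simps intro!: sum.cong)
  moreover have "cyc_pred n i < n"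
    using assms by (auto simp: cyc_pred_def)
  ultimately have "(diff_per_mat n *\<^sub>v x) $ i = real n * (x $ i - x $ cyc_pred n i)"
    using assms by (simp add: sum_of_bool_times sum_subtractf flip: sum_distrib_left)
  then show ?thesis by (simp add: cyc_pred_def)
qed

lemma avg_mat_mult_vec:
  assumes "x \<in> carrier_vec n" "i < n - 1"
  shows "(avg_mat n *\<^sub>v x) $ i = 1 / 2 * (x $ i + x $ (i + 1))"
proof -
  have "(avg_mat n *\<^sub>v x) $ i
      = (\<Sum>j = 0..<n. 1 / 2 * (of_bool (j = i) * x $ j + of_bool (j = i + 1) * x $ j))"
    using assms by (auto simp: avg_mat_def scalar_prod_def algebra_simps intro!: sum.cong)
  then show ?thesis
    using assms by (simp add: sum_of_bool_times sum.distrib flip: sum_distrib_left sum_divide_distrib)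
qed

lemma avg_per_mat_mult_vec:
  assumes "x \<in> carrier_vec n" "i < n"
  shows "(avg_per_mat n *\<^sub>v x) $ i = 1 / 2 * (x $ (if i = 0 then n - 1 else i - 1) + x $ i)"
proof -
  have "(avg_per_mat n *\<^sub>v x) $ i
      = (\<Sum>j = 0..<n. 1 / 2 * (of_bool (j = cyc_pred n i) * x $ j + of_bool (j = i) * x $ j))"
    using assms by (auto simp: avg_per_mat_def scalar_prod_def algebra_simps intro!: sum.cong)
  moreover have "cyc_pred n i < n"
    using assms by (auto simp: cyc_pred_def)
  ultimately have "(avg_per_mat n *\<^sub>v x) $ i = 1 / 2 * (x $ cyc_pred n i + x $ i)"
    using assms by (simp add: sum_of_bool_times sum.distrib flip: sum_distrib_left sum_divide_distrib)
  then show ?thesis by (simp add: cyc_pred_def)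
qed

section \<open>Block operations\<close>

definition kron_mat :: "real mat \<Rightarrow> real mat \<Rightarrow> real mat" (infixl \<open>\<otimes>\<^sub>K\<close> 70) where
  "A \<otimes>\<^sub>K B = mat (dim_row A * dim_row B) (dim_col A * dim_col B)
     (\<lambda>(i, j). A $$ (i div dim_row B, j div dim_col B) * B $$ (i mod dim_row B, j mod dim_col B))"

definition append_cols :: "real mat \<Rightarrow> real mat \<Rightarrow> real mat" (infixr \<open>|\<^sub>c\<close> 65) where
  "A |\<^sub>c B = four_block_mat A B (0\<^sub>m 0 (dim_col A)) (0\<^sub>m 0 (dim_col B))"

lemma append_cols_mult_vec:
  assumes "A \<in> carrier_mat r c1" "B \<in> carrier_mat r c2"
    and "v \<in> carrier_vec c1" "w \<in> carrier_vec c2"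
  shows "(A |\<^sub>c B) *\<^sub>v (v @\<^sub>v w) = A *\<^sub>v v + B *\<^sub>v w"
proof -
  have "(A |\<^sub>c B) *\<^sub>v (v @\<^sub>v w)
      = (A *\<^sub>v v + B *\<^sub>v w) @\<^sub>v (0\<^sub>m 0 c1 *\<^sub>v v + 0\<^sub>m 0 c2 *\<^sub>v w)"
    unfolding append_cols_def using assms
    by (subst four_block_mat_mult_vec[OF assms(1,2) _ _ assms(3,4)]) auto
  then show ?thesis using assms by (auto simp: append_vec_def)
qed

section \<open>The transport problem\<close>

datatype boundary = Mirror | Periodic

definition kappa :: "boundary \<Rightarrow> nat" where
  "kappa bc = (case bc of Mirror \<Rightarrow> 1 | Periodic \<Rightarrow> 0)"

definition Sm :: "boundary \<Rightarrow> nat \<Rightarrow> nat \<Rightarrow> real mat" where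
  "Sm bc N P = 1\<^sub>m P \<otimes>\<^sub>K
     transpose_mat (case bc of Mirror \<Rightarrow> avg_mat N | Periodic \<Rightarrow> avg_per_mat N)"

definition Dm :: "boundary \<Rightarrow> nat \<Rightarrow> nat \<Rightarrow> real mat" where
  "Dm bc N P = 1\<^sub>m P \<otimes>\<^sub>K
     transpose_mat (case bc of Mirror \<Rightarrow> diff_mat N | Periodic \<Rightarrow> diff_per_mat N)"

definition Sf :: "nat \<Rightarrow> nat \<Rightarrow> real mat" where
  "Sf N P = transpose_mat (avg_mat P) \<otimes>\<^sub>K 1\<^sub>m N"

definition Df :: "nat \<Rightarrow> nat \<Rightarrow> real mat" where
  "Df N P = transpose_mat (diff_mat P) \<otimes>\<^sub>K 1\<^sub>m N"

lemma transport_mat_carrier: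
  shows "Sm bc N P \<in> carrier_mat (N * P) ((N - kappa bc) * P)"
    and "Dm bc N P \<in> carrier_mat (N * P) ((N - kappa bc) * P)"
    and "Sf N P \<in> carrier_mat (N * P) (N * (P - 1))"
    and "Df N P \<in> carrier_mat (N * P) (N * (P - 1))"
  by (cases bc; simp add: Sm_def Dm_def Sf_def Df_def kron_mat_def kappa_def avg_mat_def
      avg_per_mat_def diff_mat_def diff_per_mat_def mult.commute)+

definition fplus :: "nat \<Rightarrow> nat \<Rightarrow> real vec \<Rightarrow> real vec \<Rightarrow> real vec" where
  "fplus N P f0 f1 = (1 / 2) \<cdot>\<^sub>v (f0 @\<^sub>v 0\<^sub>v (N * (P - 2)) @\<^sub>v f1)"

definition fminus :: "nat \<Rightarrow> nat \<Rightarrow> real vec \<Rightarrow> real vec \<Rightarrow> real vec" where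
  "fminus N P f0 f1 = real P \<cdot>\<^sub>v (- f0 @\<^sub>v 0\<^sub>v (N * (P - 2)) @\<^sub>v f1)"

definition Jp :: "real \<Rightarrow> real \<Rightarrow> real \<Rightarrow> ereal" where
  "Jp p x y =
     (if y > 0 then ereal (1 / p * (\<bar>x\<bar> powr p / y powr (p - 1)))
      else if x = 0 \<and> y = 0 then 0
      else \<infinity>)"

(* For p > 0 all components are nonnegative, so this is the 1-norm of the componentwise Jp. *)
definition Jp_norm1 :: "real \<Rightarrow> real vec \<Rightarrow> real vec \<Rightarrow> ereal" where
  "Jp_norm1 p u v = (\<Sum>i<dim_vec u. Jp p (u $ i) (v $ i))"

definition sq_norm2 :: "real vec \<Rightarrow> real" where
  "sq_norm2 v = (\<Sum>i<dim_vec v. (v $ i)\<^sup>2)"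

definition var_space :: "boundary \<Rightarrow> nat \<Rightarrow> nat \<Rightarrow> (real vec \<times> real vec) set" where
  "var_space bc N P = carrier_vec ((N - kappa bc) * P) \<times> carrier_vec (N * (P - 1))"

definition transport_cost ::
    "real \<Rightarrow> boundary \<Rightarrow> nat \<Rightarrow> nat \<Rightarrow> real vec \<Rightarrow> real vec \<Rightarrow> real vec \<times> real vec \<Rightarrow> ereal" where
  "transport_cost p bc N P f0 f1 =
     (\<lambda>(m, f). Jp_norm1 p (Sm bc N P *\<^sub>v m) (Sf N P *\<^sub>v f + fplus N P f0 f1))"

definition continuity_residual ::
    "boundary \<Rightarrow> nat \<Rightarrow> nat \<Rightarrow> real vec \<Rightarrow> real vec \<Rightarrow> real vec \<times> real vec \<Rightarrow> real" where
  "continuity_residual bc N P f0 f1 =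
     (\<lambda>(m, f). sq_norm2 ((Dm bc N P |\<^sub>c Df N P) *\<^sub>v (m @\<^sub>v f) - fminus N P f0 f1))"

definition constraint_set ::
    "boundary \<Rightarrow> nat \<Rightarrow> nat \<Rightarrow> real vec \<Rightarrow> real vec \<Rightarrow> (real vec \<times> real vec) set" where
  "constraint_set bc N P f0 f1 =
     {z. is_arg_min (continuity_residual bc N P f0 f1) (\<lambda>z. z \<in> var_space bc N P) z}"

(* The convex-analytic indicator, not the 0/1-valued indicator of HOL-Library. *)
definition cvx_indicator :: "'a set \<Rightarrow> 'a \<Rightarrow> ereal" where
  "cvx_indicator C z = (if z \<in> C then 0 else \<infinity>)"

end

theory Submission
  imports Defs
begin

text \<open>On the set where the cost is at most \<open>c\<close> and the squared residual is at most \<open>R\<close>, the variables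
  are bounded. Summing the residual over space eliminates \<open>D\<^sub>m m\<close>, which bounds the total mass of
  every time slice of \<open>f\<close>. Finite cost forces \<open>S\<^sub>f f + f\<^sup>+ \<ge> 0\<close>, so this bounds each entry of
  \<open>S\<^sub>f f + f\<^sup>+\<close> and, by recursion over time, each entry of \<open>f\<close>. Then \<open>D\<^sub>m m\<close> is bounded by the residual
  and \<open>S\<^sub>m m\<close> by \<open>\<bar>x\<bar>\<^sup>p \<le> p c y\<^sup>p\<^sup>-\<^sup>1\<close>, and up to an index shift \<open>m = S\<^sub>m m + D\<^sub>m m / (2N)\<close>. Since the epigraph
  of \<open>J\<^sub>p\<close> is closed, compactness yields minimizers. The constraint set is itself a sublevel set of
  the residual, so both problems reduce to the same statement.\<close>

section \<open>Sublevel sets of \<open>Jp\<close>, Kronecker products and bounded families\<close>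

lemma Jp_nonneg: "0 < p \<Longrightarrow> 0 \<le> Jp p x y"
  by (simp add: Jp_def)

text \<open>Multiplying out the quotient gives one inequality that also covers the degenerate case:
  at \<open>y = 0\<close> the right-hand side vanishes because \<open>0 powr (p - 1) = 0\<close>,
  which forces \<open>x = 0\<close>. Both the closedness of the epigraph and the momentum bound rest
  on this division-free form.\<close>

lemma Jp_le_ereal_iff:
  assumes "1 < p"
  shows "Jp p x y \<le> ereal t \<longleftrightarrow> 0 \<le> y \<and> 0 \<le> t \<and> \<bar>x\<bar> powr p \<le> p * t * y powr (p - 1)"
proof (cases "y > 0")
  case True
  then have "1 / p * (\<bar>x\<bar> powr p / y powr (p - 1)) \<le> t \<longleftrightarrow> \<bar>x\<bar> powr p \<le> p * t * y powr (p - 1)"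
    using assms by (simp add: divide_simps mult_ac)
  moreover have "0 \<le> 1 / p * (\<bar>x\<bar> powr p / y powr (p - 1))"
    using assms by simp
  ultimately show ?thesis
    using True by (auto simp: Jp_def simp del: times_divide_eq_left)
next
  case False
  then show ?thesis
    using assms by (auto simp: Jp_def)
qed

text \<open>Writing the row index as \<open>a * r' + b\<close> resolves the \<open>div\<close> and
  \<open>mod\<close> in \<open>kron_mat\<close>; grouping the column sum into \<open>c\<close>
  blocks of length \<open>c'\<close> does the same for the columns.\<close>

lemma kron_mat_mult_vec:
  assumes "A \<in> carrier_mat r c" "B \<in> carrier_mat r' c'" "v \<in> carrier_vec (c * c')"
    and "a < r" "b < r'"
  shows "((A \<otimes>\<^sub>K B) *\<^sub>v v) $ (a * r' + b) = (\<Sum>k<c. \<Sum>l<c'. A $$ (a, k) * B $$ (b, l) * v $ (k * c' + l))"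
proof -
  have "Suc a * r' \<le> r * r'"
    using assms by (intro mult_le_mono1) simp
  then have i: "a * r' + b < r * r'"
    using assms by simp
  have "((A \<otimes>\<^sub>K B) *\<^sub>v v) $ (a * r' + b)
      = (\<Sum>j<c * c'. A $$ (a, j div c') * B $$ (b, j mod c') * v $ j)"
    using assms i by (auto simp: kron_mat_def scalar_prod_def atLeast0LessThan intro!: sum.cong)
  also have "\<dots> = (\<Sum>k<c. \<Sum>j = k * c'..<k * c' + c'. A $$ (a, j div c') * B $$ (b, j mod c') * v $ j)"
    by (rule sum.nat_group[symmetric])
  also have "\<dots> = (\<Sum>k<c. \<Sum>l<c'. A $$ (a, k) * B $$ (b, l) * v $ (k * c' + l))"
  proof (rule sum.cong[OF refl])
    fix k
    show "(\<Sum>j = k * c'..<k * c' + c'. A $$ (a, j div c') * B $$ (b, j mod c') * v $ j)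
        = (\<Sum>l<c'. A $$ (a, k) * B $$ (b, l) * v $ (k * c' + l))"
      using sum.shift_bounds_nat_ivl[of "\<lambda>j. A $$ (a, j div c') * B $$ (b, j mod c') * v $ j" 0 "k * c'" c']
      by (auto simp: atLeast0LessThan add.commute[of c'] add.commute[of _ "k * c'"] intro!: sum.cong)
  qed
  finally show ?thesis .
qed

lemma index_cases:
  assumes "i < k * n"
  obtains a b :: nat where "a < k" "b < n" "i = a * n + b"
proof (rule that[of "i div n" "i mod n"])
  show "i div n < k"
    using assms by (simp add: less_mult_imp_div_less)
  show "i mod n < n"
    using assms by (cases "n = 0") auto
qed simp

lemma mult_vec_index_vec:
  assumes "A \<in> carrier_mat r c" "i < r"
  shows "(A *\<^sub>v vec c g) $ i = (\<Sum>j<c. A $$ (i, j) * g j)"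
  using assms by (auto simp: scalar_prod_def atLeast0LessThan intro!: sum.cong)

text \<open>Tychonoff's theorem in the product topology on \<open>nat \<Rightarrow> real\<close>.
  Coordinate functions stand in for vectors, so that compactness and continuity can be used.\<close>

lemma compact_coordinate_box: "compact {g :: nat \<Rightarrow> real. \<forall>i. g i \<in> {a..b}}"
proof -
  have "compactin (product_topology (\<lambda>_. euclidean) UNIV) (\<Pi>\<^sub>E i\<in>UNIV. {a..b})"
    by (simp add: compactin_PiE)
  moreover have "(\<Pi>\<^sub>E i\<in>UNIV. {a..b}) = {g :: nat \<Rightarrow> real. \<forall>i. g i \<in> {a..b}}"
    by (auto simp: PiE_def)
  ultimately show ?thesis
    by (metis compactin_euclidean_iff euclidean_product_topology)
qed

lemma bounded_cmult_comp: "bounded (g ` Z) \<Longrightarrow> bounded ((\<lambda>z. c * g z :: real) ` Z)"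
  using bounded_scaleR_comp[of g Z c] by simp

lemma bounded_sum_comp:
  fixes g :: "'i \<Rightarrow> 'z \<Rightarrow> real"
  assumes "\<And>i. i \<in> I \<Longrightarrow> bounded (g i ` Z)"
  shows "bounded ((\<lambda>z. \<Sum>i\<in>I. g i z) ` Z)"
  using assms
proof (induction I rule: infinite_finite_induct)
  case (insert i I)
  then show ?case 
    using bounded_plus_comp[of "g i" Z "\<lambda>z. \<Sum>i\<in>I. g i z"] by simp
qed (auto simp: image_constant_conv)

lemma closed_Jp_epigraph:
  fixes x y t :: "'a::topological_space \<Rightarrow> real"
  assumes "1 < p" "continuous_on UNIV x" "continuous_on UNIV y" "continuous_on UNIV t"
  shows "closed {w. Jp p (x w) (y w) \<le> ereal (t w)}"
proof -
  \<comment> \<open>On the first set \<open>max 0 (y w)\<close> equals \<open>y w\<close>, and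
    elsewhere it keeps the base of \<open>powr\<close> nonnegative. Since \<open>p - 1 > 0\<close>,
    the power is continuous at 0 as well, so each of the three sets is closed.\<close>
  have "{w. Jp p (x w) (y w) \<le> ereal (t w)}
      = {w. 0 \<le> y w} \<inter> {w. 0 \<le> t w} \<inter> {w. \<bar>x w\<bar> powr p \<le> p * t w * max 0 (y w) powr (p - 1)}"
    using assms(1) by (auto simp: Jp_le_ereal_iff max_def)
  then show ?thesis
    using assms
    by (auto intro!: closed_Int closed_Collect_le continuous_intros continuous_on_powr')
qed

lemma bounded_imageI: "(\<And>z. z \<in> Z \<Longrightarrow> \<bar>g z :: real\<bar> \<le> B) \<Longrightarrow> bounded (g ` Z)"
  by (rule boundedI[where B = B]) auto

lemma bounded_imageE:
  assumes "bounded (g ` Z)"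
  obtains B where "\<And>z. z \<in> Z \<Longrightarrow> \<bar>g z :: real\<bar> \<le> B"
  using assms by (auto simp: bounded_iff)

lemma bounded_of_nonneg_sum:
  fixes g :: "'i \<Rightarrow> 'z \<Rightarrow> real"
  assumes "finite I" "\<And>i z. i \<in> I \<Longrightarrow> z \<in> Z \<Longrightarrow> 0 \<le> g i z"
    and "bounded ((\<lambda>z. \<Sum>i\<in>I. g i z) ` Z)" "i \<in> I"
  shows "bounded (g i ` Z)"
proof -
  obtain B where B: "\<And>z. z \<in> Z \<Longrightarrow> \<bar>\<Sum>i\<in>I. g i z\<bar> \<le> B"
    using assms(3) by (rule bounded_imageE) blast
  have "\<bar>g i z\<bar> \<le> B" if "z \<in> Z" for z
  proof -
    have "g i z \<le> (\<Sum>i\<in>I. g i z)"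
      using assms that by (intro member_le_sum) auto
    with B[OF that] assms(2)[OF assms(4) that] show ?thesis by simp
  qed
  then show ?thesis
    by (rule bounded_imageI)
qed

lemma bounded_finite_family:
  fixes g :: "nat \<Rightarrow> 'z \<Rightarrow> real"
  assumes "\<And>i. i < n \<Longrightarrow> bounded (g i ` Z)"
  obtains B where "\<And>i z. i < n \<Longrightarrow> z \<in> Z \<Longrightarrow> \<bar>g i z\<bar> \<le> B"
proof -
  have "bounded (\<Union>i<n. g i ` Z)"
    using assms by (intro bounded_UN) auto
  then show thesis
    using that by (fastforce simp: bounded_iff)
qed

lemma bounded_image_cong: "bounded (h ` Z) \<Longrightarrow> (\<And>z. z \<in> Z \<Longrightarrow> g z = h z) \<Longrightarrow> bounded (g ` Z)"
  by (metis image_cong)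

lemma bounded_const_comp: "bounded ((\<lambda>z. c) ` Z)"
  by (simp add: image_constant_conv)

lemmas bounded_comp_intros =
  bounded_plus_comp bounded_minus_comp bounded_cmult_comp bounded_const_comp

text \<open>The components hold the coordinates of m, the coordinates of f, and upper bounds for the
  summands of the cost.\<close>

type_synonym coords = "(nat \<Rightarrow> real) \<times> (nat \<Rightarrow> real) \<times> (nat \<Rightarrow> real)"

section \<open>Coordinates of the transport problem\<close>

locale transport_problem =
  fixes p :: real and bc :: boundary and N P :: nat and f0 f1 :: "real vec"
  assumes p: "1 < p" and N: "2 \<le> N" and P: "2 \<le> P"
    and f0: "f0 \<in> carrier_vec N" and f1: "f1 \<in> carrier_vec N"
begin

abbreviation "M \<equiv> N - kappa bc"

abbreviation "V \<equiv> var_space bc N P"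

definition momentum :: "real vec \<times> real vec \<Rightarrow> nat \<Rightarrow> real" where
  "momentum z i = (Sm bc N P *\<^sub>v fst z) $ i"
definition dens :: "real vec \<times> real vec \<Rightarrow> nat \<Rightarrow> real" where
  "dens z i = (Sf N P *\<^sub>v snd z + fplus N P f0 f1) $ i"
definition divergence :: "real vec \<times> real vec \<Rightarrow> nat \<Rightarrow> real" where
  "divergence z i = (Dm bc N P *\<^sub>v fst z) $ i"
definition time_diff :: "real vec \<times> real vec \<Rightarrow> nat \<Rightarrow> real" where
  "time_diff z i = (Df N P *\<^sub>v snd z) $ i"
definition defect :: "real vec \<times> real vec \<Rightarrow> nat \<Rightarrow> real" where
  "defect z i = divergence z i + time_diff z i - fminus N P f0 f1 $ i"

lemma fplus_carrier: "fplus N P f0 f1 \<in> carrier_vec (N * P)"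
  and fminus_carrier: "fminus N P f0 f1 \<in> carrier_vec (N * P)"
proof -
  \<comment> \<open>The bracketing follows the nesting of \<open>append_vec\<close> in
    \<open>fplus\<close> and \<open>fminus\<close>.\<close>
  have eq: "N * P = N + (N * (P - 2) + N)"
    using P by (simp add: diff_mult_distrib2 flip: mult_2_right)
  show "fplus N P f0 f1 \<in> carrier_vec (N * P)"
    unfolding fplus_def eq smult_carrier_vec using f0 f1 by (intro append_carrier_vec) simp_all
  show "fminus N P f0 f1 \<in> carrier_vec (N * P)"
    unfolding fminus_def eq smult_carrier_vec using f0 f1 by (intro append_carrier_vec) simp_all
qed

lemma var_spaceD:
  "z \<in> V \<Longrightarrow> fst z \<in> carrier_vec (M * P)" "z \<in> V \<Longrightarrow> snd z \<in> carrier_vec (N * (P - 1))"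
  by (auto simp: var_space_def)

lemma transport_cost_eq:
  "transport_cost p bc N P f0 f1 z = (\<Sum>i<N * P. Jp p (momentum z i) (dens z i))"
  using transport_mat_carrier(1)[of bc N P]
  by (auto simp: transport_cost_def Jp_norm1_def momentum_def dens_def split_beta)

lemma continuity_residual_eq:
  assumes "z \<in> V"
  shows "continuity_residual bc N P f0 f1 z = (\<Sum>i<N * P. (defect z i)\<^sup>2)"
  using fminus_carrier transport_mat_carrier(2)[of bc N P] transport_mat_carrier(4)[of N P]
    append_cols_mult_vec[OF transport_mat_carrier(2,4) var_spaceD[OF assms]]
  by (auto simp: continuity_residual_def sq_norm2_def defect_def divergence_def time_diff_def
      split_beta intro!: sum.cong)

lemma index_less: "a < P \<Longrightarrow> b < N \<Longrightarrow> a * N + b < N * P"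
  using mult_le_mono1[of "Suc a" P N] by (simp add: mult.commute)

section \<open>The spatial operators acting on m\<close>

abbreviation "avg \<equiv> (case bc of Mirror \<Rightarrow> avg_mat N | Periodic \<Rightarrow> avg_per_mat N)"
abbreviation "dif \<equiv> (case bc of Mirror \<Rightarrow> diff_mat N | Periodic \<Rightarrow> diff_per_mat N)"

lemma avg_carrier: "avg \<in> carrier_mat M N" and dif_carrier: "dif \<in> carrier_mat M N"
  by (cases bc; simp add: kappa_def avg_mat_def avg_per_mat_def diff_mat_def diff_per_mat_def)+

text \<open>Each row has one entry \<open>N\<close>, one entry \<open>-N\<close> and zeros
  elsewhere. After transposition this is conservation of mass in space.\<close>

lemma sum_dif_row:
  assumes "l < M"
  shows "(\<Sum>b<N. dif $$ (l, b)) = 0"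
proof -
  have "cyc_pred N l < N" if "bc = Periodic"
    using that assms N by (auto simp: cyc_pred_def kappa_def)
  then show ?thesis
    using assms sum_of_bool_times[of _ N "\<lambda>_. 1"]
    by (cases bc) (auto simp: kappa_def diff_mat_def diff_per_mat_def sum_subtractf atLeast0LessThan
        simp flip: sum_distrib_left)
qed

text \<open>Both matrices use the same two-point stencil. After scaling by
  \<open>1 / (2 * N)\<close>, the halves cancel at the left neighbour and add up to 1 at the right
  one. The right one is column \<open>l + 1\<close> for mirror and column \<open>l\<close> for
  periodic conditions, hence the shift \<open>kappa bc\<close>.\<close>

lemma avg_dif_entry:
  assumes "l < M" "b < N"
  shows "avg $$ (l, b) + dif $$ (l, b) / (2 * real N) = of_bool (b = l + kappa bc)"
  using assms
  by (cases bc) (auto simp: kappa_def avg_mat_def avg_per_mat_def diff_mat_def diff_per_mat_def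
      cyc_pred_def field_simps)

lemma one_kron_mult_vec:
  assumes "A \<in> carrier_mat M N" "v \<in> carrier_vec (M * P)" "a < P" "b < N"
  shows "((1\<^sub>m P \<otimes>\<^sub>K transpose_mat A) *\<^sub>v v) $ (a * N + b) = (\<Sum>l<M. A $$ (l, b) * v $ (a * M + l))"
proof -
  have "((1\<^sub>m P \<otimes>\<^sub>K transpose_mat A) *\<^sub>v v) $ (a * N + b)
      = (\<Sum>k<P. \<Sum>l<M. 1\<^sub>m P $$ (a, k) * transpose_mat A $$ (b, l) * v $ (k * M + l))"
    using assms by (intro kron_mat_mult_vec) (auto simp: mult.commute)
  also have "\<dots> = (\<Sum>k = 0..<P. of_bool (k = a) * (\<Sum>l<M. A $$ (l, b) * v $ (k * M + l)))"
    unfolding atLeast0LessThan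
  proof (rule sum.cong[OF refl])
    fix k
    assume "k \<in> {..<P}"
    then show "(\<Sum>l<M. 1\<^sub>m P $$ (a, k) * transpose_mat A $$ (b, l) * v $ (k * M + l))
        = of_bool (k = a) * (\<Sum>l<M. A $$ (l, b) * v $ (k * M + l))"
      using assms by (cases "k = a") auto
  qed
  also have "\<dots> = (\<Sum>l<M. A $$ (l, b) * v $ (a * M + l))"
    using assms by (subst sum_of_bool_times) auto
  finally show ?thesis .
qed

lemma momentum_eq:
  "z \<in> V \<Longrightarrow> a < P \<Longrightarrow> b < N \<Longrightarrow>
    momentum z (a * N + b) = (\<Sum>l<M. avg $$ (l, b) * fst z $ (a * M + l))"
  unfolding momentum_def Sm_def by (rule one_kron_mult_vec[OF avg_carrier var_spaceD(1)])

lemma divergence_eq: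
  "z \<in> V \<Longrightarrow> a < P \<Longrightarrow> b < N \<Longrightarrow>
    divergence z (a * N + b) = (\<Sum>l<M. dif $$ (l, b) * fst z $ (a * M + l))"
  unfolding divergence_def Dm_def by (rule one_kron_mult_vec[OF dif_carrier var_spaceD(1)])

text \<open>A discrete divergence theorem: exchanging the sums leaves row sums of
  \<open>dif\<close>. It removes m from the mass balance of a time slice.\<close>

lemma sum_divergence:
  assumes "z \<in> V" "a < P"
  shows "(\<Sum>b<N. divergence z (a * N + b)) = 0"
proof -
  have "(\<Sum>b<N. divergence z (a * N + b)) = (\<Sum>l<M. \<Sum>b<N. dif $$ (l, b) * fst z $ (a * M + l))"
    using assms by (subst sum.swap) (simp add: divergence_eq)
  also have "\<dots> = 0"
    by (simp add: sum_dif_row flip: sum_distrib_right)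
  finally show ?thesis .
qed

text \<open>By \<open>avg_dif_entry\<close>, the combination at column \<open>l + kappa bc\<close>
  selects exactly the entry \<open>l\<close> of the block. Thus m is controlled by its averages and
  differences together, although the cost sees only the averages.\<close>

lemma fst_eq_momentum_divergence:
  assumes "z \<in> V" "a < P" "l < M"
  shows "fst z $ (a * M + l)
    = momentum z (a * N + (l + kappa bc)) + 1 / (2 * real N) * divergence z (a * N + (l + kappa bc))"
proof -
  have b: "l + kappa bc < N"
    using assms by simp
  have "momentum z (a * N + (l + kappa bc)) + 1 / (2 * real N) * divergence z (a * N + (l + kappa bc))
     = (\<Sum>k<M. (avg $$ (k, l + kappa bc) + dif $$ (k, l + kappa bc) / (2 * real N)) * fst z $ (a * M + k))"
    unfolding momentum_eq[OF assms(1,2) b] divergence_eq[OF assms(1,2) b] sum_distrib_left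
    by (simp add: algebra_simps flip: sum.distrib)
  also have "\<dots> = (\<Sum>k=0..<M. of_bool (k = l) * fst z $ (a * M + k))"
    using b by (auto simp: avg_dif_entry atLeast0LessThan intro!: sum.cong)
  also have "\<dots> = fst z $ (a * M + l)"
    using assms by (subst sum_of_bool_times) auto
  finally show ?thesis by simp
qed

section \<open>The temporal operators acting on f\<close>

definition slice :: "real vec \<times> real vec \<Rightarrow> nat \<Rightarrow> nat \<Rightarrow> real" where
  "slice z a b = (if a < P - 1 then snd z $ (a * N + b) else 0)"
text \<open>Together with \<open>slice\<close> this extends the \<open>P - 1\<close> time slices of
  f by zero at both ends, so that \<open>dens_eq\<close> and \<open>time_diff_eq\<close> hold
  uniformly for \<open>a < P\<close>; the data \<open>f0\<close> and \<open>f1\<close> enter only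
  through \<open>fplus\<close> and \<open>fminus\<close>. The case split is essential, as
  \<open>0 - 1 = 0\<close> on \<open>nat\<close> would return slice 0.\<close>

definition prev_slice :: "real vec \<times> real vec \<Rightarrow> nat \<Rightarrow> nat \<Rightarrow> real" where
  "prev_slice z a b = (if a = 0 then 0 else slice z (a - 1) b)"

lemma kron_one_mult_vec:
  assumes "A \<in> carrier_mat (P - 1) P" "v \<in> carrier_vec (N * (P - 1))" "a < P" "b < N"
  shows "((transpose_mat A \<otimes>\<^sub>K 1\<^sub>m N) *\<^sub>v v) $ (a * N + b) = (\<Sum>k<P - 1. A $$ (k, a) * v $ (k * N + b))"
proof -
  have "((transpose_mat A \<otimes>\<^sub>K 1\<^sub>m N) *\<^sub>v v) $ (a * N + b)
      = (\<Sum>k<P - 1. \<Sum>l<N. transpose_mat A $$ (a, k) * 1\<^sub>m N $$ (b, l) * v $ (k * N + l))"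
    using assms by (intro kron_mat_mult_vec) (auto simp: mult.commute)
  also have "\<dots> = (\<Sum>k<P - 1. \<Sum>l = 0..<N. of_bool (l = b) * (A $$ (k, a) * v $ (k * N + l)))"
    unfolding atLeast0LessThan using assms by (intro sum.cong[OF refl]) auto
  also have "\<dots> = (\<Sum>k<P - 1. A $$ (k, a) * v $ (k * N + b))"
    using assms by (simp add: sum_of_bool_times)
  finally show ?thesis .
qed

lemma sum_of_bool_slice:
  "(\<Sum>k<P - 1. of_bool (a = k) * snd z $ (k * N + b)) = slice z a b"
  "a < P \<Longrightarrow> (\<Sum>k<P - 1. of_bool (a = k + 1) * snd z $ (k * N + b)) = prev_slice z a b"
proof -
  show "(\<Sum>k<P - 1. of_bool (a = k) * snd z $ (k * N + b)) = slice z a b" for a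
    using sum_of_bool_times[of a "P - 1" "\<lambda>k. snd z $ (k * N + b)"]
    by (auto simp: slice_def atLeast0LessThan eq_commute[of a])
  note * = this
  show "(\<Sum>k<P - 1. of_bool (a = k + 1) * snd z $ (k * N + b)) = prev_slice z a b" if "a < P"
    using *[of "a - 1"] that by (cases a) (auto simp: prev_slice_def)
qed

lemma dens_eq:
  assumes "z \<in> V" "a < P" "b < N"
  shows "dens z (a * N + b)
    = 1 / 2 * (slice z a b + prev_slice z a b) + fplus N P f0 f1 $ (a * N + b)"
proof -
  have "(Sf N P *\<^sub>v snd z) $ (a * N + b) = (\<Sum>k<P - 1. avg_mat P $$ (k, a) * snd z $ (k * N + b))"
    unfolding Sf_def using assms
    by (intro kron_one_mult_vec var_spaceD) (auto simp: avg_mat_def)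
  also have "\<dots> = (\<Sum>k<P - 1. 1 / 2 * (of_bool (a = k) * snd z $ (k * N + b)
      + of_bool (a = k + 1) * snd z $ (k * N + b)))"
    using assms by (auto simp: avg_mat_def intro!: sum.cong)
  also have "\<dots> = 1 / 2 * (slice z a b + prev_slice z a b)"
    unfolding sum_distrib_left[symmetric] sum.distrib using assms by (simp only: sum_of_bool_slice)
  finally show ?thesis
    using fplus_carrier index_less[OF assms(2,3)] by (simp add: dens_def)
qed

lemma time_diff_eq:
  assumes "z \<in> V" "a < P" "b < N"
  shows "time_diff z (a * N + b) = real P * (prev_slice z a b - slice z a b)"
proof -
  have "(Df N P *\<^sub>v snd z) $ (a * N + b) = (\<Sum>k<P - 1. diff_mat P $$ (k, a) * snd z $ (k * N + b))"
    unfolding Df_def using assms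
    by (intro kron_one_mult_vec var_spaceD) (auto simp: diff_mat_def)
  also have "\<dots> = (\<Sum>k<P - 1. real P * (of_bool (a = k + 1) * snd z $ (k * N + b)
      - of_bool (a = k) * snd z $ (k * N + b)))"
    using assms by (auto simp: diff_mat_def intro!: sum.cong)
  also have "\<dots> = real P * (prev_slice z a b - slice z a b)"
    unfolding sum_distrib_left[symmetric] sum_subtractf using assms by (simp only: sum_of_bool_slice)
  finally show ?thesis
    by (simp add: time_diff_def)
qed

section \<open>Boundedness of sublevel sets\<close>

text \<open>Two separate levels let the set serve both problems: \<open>R\<close> is the minimal
  residual in the constrained one and \<open>c / lam\<close> in the penalized one.\<close>

definition "sublevel c R = {z \<in> V. transport_cost p bc N P f0 f1 z \<le> ereal c
  \<and> continuity_residual bc N P f0 f1 z \<le> R}"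

lemma sublevel_subset: "z \<in> sublevel c R \<Longrightarrow> z \<in> V"
  by (simp add: sublevel_def)

lemma transport_cost_nonneg: "0 \<le> transport_cost p bc N P f0 f1 z"
  using p by (auto simp: transport_cost_eq intro!: sum_nonneg Jp_nonneg)

lemma Jp_le_on_sublevel:
  assumes "z \<in> sublevel c R" "i < N * P"
  shows "Jp p (momentum z i) (dens z i) \<le> ereal c"
proof -
  have "Jp p (momentum z i) (dens z i) \<le> (\<Sum>i<N * P. Jp p (momentum z i) (dens z i))"
    using assms p sum_mono2[of "{..<N * P}" "{i}" "\<lambda>i. Jp p (momentum z i) (dens z i)"]
    by (simp add: Jp_nonneg)
  then show ?thesis
    using assms by (auto simp: sublevel_def transport_cost_eq)
qed

lemma dens_nonneg_on_sublevel: "z \<in> sublevel c R \<Longrightarrow> i < N * P \<Longrightarrow> 0 \<le> dens z i"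
  using Jp_le_on_sublevel p by (auto simp: Jp_le_ereal_iff)

lemma bounded_defect:
  assumes "i < N * P"
  shows "bounded ((\<lambda>z. defect z i) ` sublevel c R)"
proof -
  have "\<bar>defect z i\<bar> \<le> sqrt R" if "z \<in> sublevel c R" for z
  proof -
    have "(defect z i)\<^sup>2 \<le> (\<Sum>i<N * P. (defect z i)\<^sup>2)"
      using assms by (intro member_le_sum) auto
    also have "\<dots> \<le> R"
      using that by (auto simp: sublevel_def continuity_residual_eq)
    finally show ?thesis
      by (intro real_le_rsqrt) simp
  qed
  then show ?thesis
    by (rule bounded_imageI)
qed

text \<open>Summing the defect over space cancels the divergence, and what remains is the change of
  mass between consecutive slices.\<close>

lemma mass_step:
  assumes "z \<in> V" "a < P"
  shows "(\<Sum>b<N. slice z a b) = (\<Sum>b<N. prev_slice z a b)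
    - 1 / real P * ((\<Sum>b<N. defect z (a * N + b)) + (\<Sum>b<N. fminus N P f0 f1 $ (a * N + b)))"
proof -
  have "(\<Sum>b<N. defect z (a * N + b)) + (\<Sum>b<N. fminus N P f0 f1 $ (a * N + b))
      = (\<Sum>b<N. divergence z (a * N + b)) + (\<Sum>b<N. time_diff z (a * N + b))"
    by (simp add: defect_def sum.distrib sum_subtractf)
  also have "\<dots> = real P * ((\<Sum>b<N. prev_slice z a b) - (\<Sum>b<N. slice z a b))"
    using assms by (simp add: sum_divergence time_diff_eq flip: sum_distrib_left sum_subtractf)
  finally show ?thesis
    using P by (simp add: field_simps)
qed

lemma bounded_mass:
  assumes "a < P"
  shows "bounded ((\<lambda>z. \<Sum>b<N. slice z a b) ` sublevel c R)"
    and "bounded ((\<lambda>z. \<Sum>b<N. prev_slice z a b) ` sublevel c R)"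
proof -
  have *: "bounded ((\<lambda>z. \<Sum>b<N. slice z a b) ` sublevel c R)" if "a < P" for a
    using that
  proof (induction a rule: less_induct)
    case (less a)
    \<comment> \<open>The recursion starts from the zero slice before time 0;
      \<open>mass_step\<close> then adds a bounded increment.\<close>
    have "bounded ((\<lambda>z. \<Sum>b<N. prev_slice z a b) ` sublevel c R)"
      using less.IH[of "a - 1"] less.prems by (cases "a = 0") (auto simp: prev_slice_def bounded_const_comp)
    then have "bounded ((\<lambda>z. (\<Sum>b<N. prev_slice z a b)
        - 1 / real P * ((\<Sum>b<N. defect z (a * N + b)) + (\<Sum>b<N. fminus N P f0 f1 $ (a * N + b))))
        ` sublevel c R)"
      using less.prems by (intro bounded_comp_intros bounded_sum_comp[OF bounded_defect] index_less) auto
    then show ?case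
      by (rule bounded_image_cong) (rule mass_step[OF sublevel_subset less.prems])
  qed
  show "bounded ((\<lambda>z. \<Sum>b<N. slice z a b) ` sublevel c R)"
    by (rule *[OF assms])
  show "bounded ((\<lambda>z. \<Sum>b<N. prev_slice z a b) ` sublevel c R)"
    using *[of "a - 1"] assms by (cases "a = 0") (auto simp: prev_slice_def bounded_const_comp)
qed

text \<open>Bounded mass alone does not bound entries, since slices of f may change sign. The
  averaged density \<open>dens\<close> is nonnegative by finite cost, and its total is affine in two
  consecutive masses, so each entry is at most a bounded total.\<close>

lemma bounded_dens:
  assumes "a < P" "b < N"
  shows "bounded ((\<lambda>z. dens z (a * N + b)) ` sublevel c R)"
proof (rule bounded_of_nonneg_sum[where I = "{..<N}" and g = "\<lambda>b z. dens z (a * N + b)" and i = b])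
  have "bounded ((\<lambda>z. 1 / 2 * ((\<Sum>b<N. slice z a b) + (\<Sum>b<N. prev_slice z a b))
      + (\<Sum>b<N. fplus N P f0 f1 $ (a * N + b))) ` sublevel c R)"
    using assms by (intro bounded_comp_intros bounded_mass)
  then show "bounded ((\<lambda>z. \<Sum>b<N. dens z (a * N + b)) ` sublevel c R)"
    by (rule bounded_image_cong)
      (use assms in \<open>simp add: dens_eq[OF sublevel_subset] sum.distrib flip: sum_divide_distrib\<close>)
qed (use assms in \<open>auto intro!: dens_nonneg_on_sublevel index_less\<close>)

text \<open>Solving \<open>dens_eq\<close> for the current slice gives a forward recursion in time
  that starts from zero.\<close>

lemma bounded_slice:
  assumes "a < P" "b < N"
  shows "bounded ((\<lambda>z. slice z a b) ` sublevel c R)"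
    and "bounded ((\<lambda>z. prev_slice z a b) ` sublevel c R)"
proof -
  have *: "bounded ((\<lambda>z. slice z a b) ` sublevel c R)" if "a < P" for a
    using that
  proof (induction a rule: less_induct)
    case (less a)
    have "bounded ((\<lambda>z. prev_slice z a b) ` sublevel c R)"
      using less.IH[of "a - 1"] less.prems by (cases "a = 0") (auto simp: prev_slice_def bounded_const_comp)
    then have "bounded ((\<lambda>z. 2 * dens z (a * N + b) - prev_slice z a b - 2 * fplus N P f0 f1 $ (a * N + b))
        ` sublevel c R)"
      using less.prems assms by (intro bounded_comp_intros bounded_dens) auto
    then show ?case
      by (rule bounded_image_cong) (use less.prems assms in \<open>subst dens_eq[OF sublevel_subset[of _ c R]]; simp add: field_simps\<close>)
  qed
  show "bounded ((\<lambda>z. slice z a b) ` sublevel c R)"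
    by (rule *[OF assms(1)])
  show "bounded ((\<lambda>z. prev_slice z a b) ` sublevel c R)"
    using *[of "a - 1"] assms by (cases "a = 0") (auto simp: prev_slice_def bounded_const_comp)
qed

lemma bounded_momentum:
  assumes "a < P" "b < N"
  shows "bounded ((\<lambda>z. momentum z (a * N + b)) ` sublevel c R)"
proof -
  obtain B where B: "\<And>z. z \<in> sublevel c R \<Longrightarrow> \<bar>dens z (a * N + b)\<bar> \<le> B"
    using bounded_dens[OF assms, of c R] by (rule bounded_imageE) blast
  \<comment> \<open>For \<open>\<bar>x\<bar> > 1\<close> one has
    \<open>\<bar>x\<bar> \<le> \<bar>x\<bar> powr p\<close> because \<open>p > 1\<close>, so no p-th
    root has to be taken; smaller values account for the 1 in the maximum.\<close>
  have "\<bar>momentum z (a * N + b)\<bar> \<le> max 1 (p * c * B powr (p - 1))" if z: "z \<in> sublevel c R" for z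
  proof (cases "\<bar>momentum z (a * N + b)\<bar> \<le> 1")
    case False
    have *: "0 \<le> dens z (a * N + b)" "0 \<le> c"
      "\<bar>momentum z (a * N + b)\<bar> powr p \<le> p * c * dens z (a * N + b) powr (p - 1)"
      using Jp_le_on_sublevel[OF z index_less[OF assms]] p by (auto simp: Jp_le_ereal_iff)
    have "\<bar>momentum z (a * N + b)\<bar> powr 1 \<le> \<bar>momentum z (a * N + b)\<bar> powr p"
      using False p by (intro powr_mono) auto
    also note *(3)
    also have "p * c * dens z (a * N + b) powr (p - 1) \<le> p * c * B powr (p - 1)"
      using * B[OF z] p by (intro mult_left_mono powr_mono2) auto
    finally show ?thesis
      by simp
  qed simp
  then show ?thesis
    by (rule bounded_imageI)
qed

text \<open>The definition of \<open>defect\<close> is solved for the divergence; the time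
  difference is bounded because the slices are.\<close>

lemma bounded_divergence:
  assumes "a < P" "b < N"
  shows "bounded ((\<lambda>z. divergence z (a * N + b)) ` sublevel c R)"
proof -
  have "bounded ((\<lambda>z. defect z (a * N + b) - real P * (prev_slice z a b - slice z a b)
      + fminus N P f0 f1 $ (a * N + b)) ` sublevel c R)"
    using assms by (intro bounded_comp_intros bounded_defect bounded_slice index_less)
  then show ?thesis
    by (rule bounded_image_cong)
      (use assms in \<open>simp add: defect_def time_diff_eq[OF sublevel_subset]\<close>)
qed

lemma bounded_coordinates:
  obtains B where "\<And>i z. i < M * P \<Longrightarrow> z \<in> sublevel c R \<Longrightarrow> \<bar>fst z $ i\<bar> \<le> B"
    and "\<And>i z. i < N * (P - 1) \<Longrightarrow> z \<in> sublevel c R \<Longrightarrow> \<bar>snd z $ i\<bar> \<le> B"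
proof -
  have "bounded ((\<lambda>z. fst z $ i) ` sublevel c R)" if "i < M * P" for i
  proof -
    have "i < P * M"
      using that by (simp add: mult.commute)
    then obtain a l where i: "a < P" "l < M" "i = a * M + l"
      by (rule index_cases)
    have "bounded ((\<lambda>z. momentum z (a * N + (l + kappa bc))
        + 1 / (2 * real N) * divergence z (a * N + (l + kappa bc))) ` sublevel c R)"
      using i by (intro bounded_comp_intros bounded_momentum bounded_divergence) auto
    then show ?thesis
      by (rule bounded_image_cong)
        (use i in \<open>blast intro: fst_eq_momentum_divergence sublevel_subset\<close>)
  qed
  then obtain B1 where B1: "\<And>i z. i < M * P \<Longrightarrow> z \<in> sublevel c R \<Longrightarrow> \<bar>fst z $ i\<bar> \<le> B1"
    using bounded_finite_family[of "M * P" "\<lambda>i z. fst z $ i"] by metis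
  have "bounded ((\<lambda>z. snd z $ i) ` sublevel c R)" if "i < N * (P - 1)" for i
  proof -
    have "i < (P - 1) * N"
      using that by (simp add: mult.commute)
    then obtain a b where i: "a < P - 1" "b < N" "i = a * N + b"
      by (rule index_cases)
    then show ?thesis
      using bounded_slice(1)[of a b] by (simp add: slice_def)
  qed
  then obtain B2 where B2: "\<And>i z. i < N * (P - 1) \<Longrightarrow> z \<in> sublevel c R \<Longrightarrow> \<bar>snd z $ i\<bar> \<le> B2"
    using bounded_finite_family[of "N * (P - 1)" "\<lambda>i z. snd z $ i"] by metis
  show thesis
    by (rule that[of "max B1 B2"]) (use B1 B2 in force)+
qed

section \<open>Existence of minimizers\<close>

definition state :: "coords \<Rightarrow> real vec \<times> real vec" where
  "state w = (vec (M * P) (fst w), vec (N * (P - 1)) (fst (snd w)))"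

lemma state_in_V: "state w \<in> V"
  by (simp add: state_def var_space_def)

lemma continuous_on_coordinate:
  "continuous_on UNIV (\<lambda>w :: coords. fst w j)"
  "continuous_on UNIV (\<lambda>w :: coords. fst (snd w) j)"
  "continuous_on UNIV (\<lambda>w :: coords. snd (snd w) j)"
  by (rule continuous_on_product_then_coordinatewise,
      intro continuous_on_fst continuous_on_snd continuous_on_id)+

text \<open>Each of these quantities is an affine function of finitely many coordinates.\<close>

lemma continuous_on_state:
  assumes "i < N * P"
  shows "continuous_on UNIV (\<lambda>w :: coords. momentum (state w) i)"
    and "continuous_on UNIV (\<lambda>w :: coords. dens (state w) i)"
    and "continuous_on UNIV (\<lambda>w :: coords. defect (state w) i)"
  using assms fplus_carrier
  by (auto simp: momentum_def dens_def defect_def divergence_def time_diff_def state_def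
      mult_vec_index_vec[OF transport_mat_carrier(1)] mult_vec_index_vec[OF transport_mat_carrier(2)]
      mult_vec_index_vec[OF transport_mat_carrier(3)] mult_vec_index_vec[OF transport_mat_carrier(4)]
      simp del: index_mult_mat_vec One_nat_def
      intro!: continuous_intros continuous_on_coordinate)

lemma continuous_on_residual:
  "continuous_on UNIV (\<lambda>w :: coords.
    continuity_residual bc N P f0 f1 (state w))"
  by (auto simp: continuity_residual_eq[OF state_in_V] intro!: continuous_intros continuous_on_state)

text \<open>A point \<open>(g, h, t)\<close> encodes the state \<open>(g, h)\<close> with an upper bound \<open>t\<close> for the
  components of its cost; this replaces the extended-real cost by the continuous function \<open>\<Sum>t\<close>.\<close>
definition bounded_epigraph :: "real \<Rightarrow> real \<Rightarrow> real \<Rightarrow> coords set" where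
  "bounded_epigraph c R B = {w. (\<forall>i. fst w i \<in> {-B..B}) \<and> (\<forall>i. fst (snd w) i \<in> {-B..B})
   \<and> (\<forall>i. snd (snd w) i \<in> {-B..B})
   \<and> (\<forall>i\<in>{..<N * P}. Jp p (momentum (state w) i) (dens (state w) i) \<le> ereal (snd (snd w) i))
   \<and> continuity_residual bc N P f0 f1 (state w) \<le> R \<and> (\<Sum>i<N * P. snd (snd w) i) \<le> c}"

text \<open>A compact box is cut by closed conditions. Closedness of the \<open>Jp\<close> epigraph
  takes the place of lower semicontinuity of the cost.\<close>

lemma compact_bounded_epigraph: "compact (bounded_epigraph c R B)"
proof -
  let ?box = "{g :: nat \<Rightarrow> real. \<forall>i. g i \<in> {-B..B}}"
  let ?J = "\<lambda>i. {w. Jp p (momentum (state w) i) (dens (state w) i) \<le> ereal (snd (snd w) i)}"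
  let ?R = "{w :: coords.
    continuity_residual bc N P f0 f1 (state w) \<le> R}"
  let ?c = "{w :: coords. (\<Sum>i<N * P. snd (snd w) i) \<le> c}"
  have "bounded_epigraph c R B = (?box \<times> ?box \<times> ?box) \<inter> ((\<Inter>i\<in>{..<N * P}. ?J i) \<inter> ?R \<inter> ?c)"
    unfolding bounded_epigraph_def by force
  moreover have "closed (\<Inter>i\<in>{..<N * P}. ?J i)"
    using p by (intro closed_INT ballI closed_Jp_epigraph continuous_on_state continuous_on_coordinate) auto
  moreover have "closed ?R"
    by (intro closed_Collect_le continuous_on_residual continuous_intros)
  moreover have "closed ?c"
    by (intro closed_Collect_le continuous_intros continuous_on_coordinate)
  ultimately show ?thesis
    by (simp only:) (intro compact_Int_closed compact_Times compact_coordinate_box closed_Int)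
qed

lemma epigraph_lift:
  assumes B: "\<And>i z. i < M * P \<Longrightarrow> z \<in> sublevel c R \<Longrightarrow> \<bar>fst z $ i\<bar> \<le> B"
    "\<And>i z. i < N * (P - 1) \<Longrightarrow> z \<in> sublevel c R \<Longrightarrow> \<bar>snd z $ i\<bar> \<le> B" "0 \<le> B" "c \<le> B"
    and z: "z \<in> sublevel c R"
  obtains w where "w \<in> bounded_epigraph c R B" "state w = z"
    "transport_cost p bc N P f0 f1 z = ereal (\<Sum>i<N * P. snd (snd w) i)"
proof -
  \<comment> \<open>The exact summands of the cost, which are finite on the sublevel set. They lie
    between 0 and \<open>c\<close>, hence the assumption \<open>c \<le> B\<close>; padding with 0
    keeps the remaining coordinates in the box.\<close>
  define t where "t i = (if i < N * P then real_of_ereal (Jp p (momentum z i) (dens z i)) else 0)" for i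
  define w where "w = (\<lambda>i. if i < M * P then fst z $ i else 0, \<lambda>i. if i < N * (P - 1) then snd z $ i else 0, t)"
  have Jt: "Jp p (momentum z i) (dens z i) = ereal (t i)" if "i < N * P" for i
    using Jp_nonneg[of p "momentum z i" "dens z i"] Jp_le_on_sublevel[OF z that] p that
    by (cases "Jp p (momentum z i) (dens z i)") (auto simp: t_def)
  have t: "0 \<le> t i \<and> t i \<le> B" for i
  proof (cases "i < N * P")
    case True
    then show ?thesis
      using Jt[OF True] Jp_nonneg[of p "momentum z i" "dens z i"] Jp_le_on_sublevel[OF z True] p B(4)
      by auto
  qed (use B(3) in \<open>simp add: t_def\<close>)
  have cost: "transport_cost p bc N P f0 f1 z = ereal (\<Sum>i<N * P. t i)"
    by (simp add: transport_cost_eq Jt)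
  have state: "state w = z"
    using var_spaceD[OF sublevel_subset[OF z]]
    by (auto simp: state_def w_def intro!: prod_eqI eq_vecI)
  have "fst w i \<in> {-B..B} \<and> fst (snd w) i \<in> {-B..B} \<and> snd (snd w) i \<in> {-B..B}" for i
    using B(1)[OF _ z, of i] B(2)[OF _ z, of i] t[of i] B(3) by (auto simp: w_def abs_le_iff)
  moreover have "continuity_residual bc N P f0 f1 z \<le> R" "(\<Sum>i<N * P. t i) \<le> c"
    using z by (auto simp: sublevel_def cost)
  ultimately have "w \<in> bounded_epigraph c R B"
    using Jt by (auto simp: bounded_epigraph_def state) (auto simp: w_def)
  then show thesis
    using that state cost by (auto simp: w_def)
qed

text \<open>Counterpart of \<open>epigraph_lift\<close>: a point of the epigraph only overestimates
  the cost, while the lift attains it. Minimizing over the epigraph therefore minimizes over the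
  sublevel set.\<close>

lemma cost_le_epigraph:
  assumes "w \<in> bounded_epigraph c R B"
  shows "transport_cost p bc N P f0 f1 (state w) \<le> ereal (\<Sum>i<N * P. snd (snd w) i)"
    and "state w \<in> sublevel c R"
proof -
  show *: "transport_cost p bc N P f0 f1 (state w) \<le> ereal (\<Sum>i<N * P. snd (snd w) i)"
    using assms unfolding transport_cost_eq sum_ereal[symmetric]
    by (intro sum_mono) (simp add: bounded_epigraph_def)
  also have "\<dots> \<le> ereal c"
    using assms by (simp add: bounded_epigraph_def)
  finally show "state w \<in> sublevel c R"
    using assms by (simp add: sublevel_def state_in_V bounded_epigraph_def)
qed

text \<open>Weierstrass' theorem on the compact epigraph, where the objective is continuous and
  real-valued. The instance \<open>lam = 0\<close> serves the constrained problem.\<close>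

lemma minimizer_on_sublevel:
  assumes "z0 \<in> sublevel c R"
  obtains z where "z \<in> sublevel c R"
    "\<And>y. y \<in> sublevel c R \<Longrightarrow>
      transport_cost p bc N P f0 f1 z + ereal (lam * continuity_residual bc N P f0 f1 z)
      \<le> transport_cost p bc N P f0 f1 y + ereal (lam * continuity_residual bc N P f0 f1 y)"
proof -
  obtain B0 where "\<And>i z. i < M * P \<Longrightarrow> z \<in> sublevel c R \<Longrightarrow> \<bar>fst z $ i\<bar> \<le> B0"
    "\<And>i z. i < N * (P - 1) \<Longrightarrow> z \<in> sublevel c R \<Longrightarrow> \<bar>snd z $ i\<bar> \<le> B0"
    by (rule bounded_coordinates[of c R]) blast
  moreover define B where "B = max B0 (max 0 c)"
  ultimately have B: "\<And>i z. i < M * P \<Longrightarrow> z \<in> sublevel c R \<Longrightarrow> \<bar>fst z $ i\<bar> \<le> B"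
    "\<And>i z. i < N * (P - 1) \<Longrightarrow> z \<in> sublevel c R \<Longrightarrow> \<bar>snd z $ i\<bar> \<le> B" "0 \<le> B" "c \<le> B"
    by (auto simp: B_def le_max_iff_disj)
  have lift: "\<exists>w. w \<in> bounded_epigraph c R B \<and> state w = y
      \<and> transport_cost p bc N P f0 f1 y = ereal (\<Sum>i<N * P. snd (snd w) i)"
    if "y \<in> sublevel c R" for y
    by (rule epigraph_lift[of c R B y]) (use B that in blast)+
  let ?F = "\<lambda>w :: coords.
    (\<Sum>i<N * P. snd (snd w) i) + lam * continuity_residual bc N P f0 f1 (state w)"
  have "continuous_on UNIV ?F"
    by (intro continuous_intros continuous_on_coordinate continuous_on_residual)
  then have "continuous_on (bounded_epigraph c R B) ?F"
    by (rule continuous_on_subset) simp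
  moreover have "bounded_epigraph c R B \<noteq> {}"
    using lift[OF assms] by blast
  ultimately obtain w where w: "w \<in> bounded_epigraph c R B" "\<And>v. v \<in> bounded_epigraph c R B \<Longrightarrow> ?F w \<le> ?F v"
    using continuous_attains_inf[OF compact_bounded_epigraph] by blast
  show thesis
  proof (rule that[of "state w"])
    show "state w \<in> sublevel c R"
      by (rule cost_le_epigraph[OF w(1)])
    fix y
    assume "y \<in> sublevel c R"
    then obtain v where v: "v \<in> bounded_epigraph c R B" "state v = y"
      "transport_cost p bc N P f0 f1 y = ereal (\<Sum>i<N * P. snd (snd v) i)"
      using lift by blast
    have "transport_cost p bc N P f0 f1 (state w) + ereal (lam * continuity_residual bc N P f0 f1 (state w))
        \<le> ereal (?F w)"
      using cost_le_epigraph(1)[OF w(1)] by (simp flip: plus_ereal.simps(1) add: add_right_mono)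
    also have "\<dots> \<le> ereal (?F v)"
      using w(2)[OF v(1)] by simp
    also have "\<dots> = transport_cost p bc N P f0 f1 y + ereal (lam * continuity_residual bc N P f0 f1 y)"
      by (simp add: v)
    finally show "transport_cost p bc N P f0 f1 (state w) + ereal (lam * continuity_residual bc N P f0 f1 (state w))
        \<le> transport_cost p bc N P f0 f1 y + ereal (lam * continuity_residual bc N P f0 f1 y)" .
  qed
qed

section \<open>Existence for the constrained and the penalized problem\<close>

lemma V_nonempty: "V \<noteq> {}"
  using state_in_V by blast

text \<open>If \<open>F\<close> is infinite throughout \<open>V\<close>, every point of
  \<open>V\<close> is a minimizer. This disposes of infeasibility and infinite cost at once and
  provides a point of finite value otherwise.\<close>

lemma exists_arg_min_if_not_infinite:
  assumes "\<And>z0. z0 \<in> V \<Longrightarrow> F z0 \<noteq> (\<infinity>::ereal) \<Longrightarrow> \<exists>z. is_arg_min F (\<lambda>z. z \<in> V) z"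
  shows "\<exists>z. is_arg_min F (\<lambda>z. z \<in> V) z"
proof (cases "\<exists>z0\<in>V. F z0 \<noteq> \<infinity>")
  case True
  then show ?thesis using assms by blast
next
  case False
  moreover obtain z where "z \<in> V"
    using V_nonempty by blast
  ultimately show ?thesis
    unfolding is_arg_min_def by (intro exI[of _ z]) auto
qed

lemma constrained_minimizer:
  "\<exists>z. is_arg_min
    (\<lambda>z. transport_cost p bc N P f0 f1 z + cvx_indicator (constraint_set bc N P f0 f1) z)
    (\<lambda>z. z \<in> V) z"
proof (rule exists_arg_min_if_not_infinite)
  let ?C = "constraint_set bc N P f0 f1" and ?T = "transport_cost p bc N P f0 f1"
    and ?r = "continuity_residual bc N P f0 f1"
  fix z0
  assume z0: "z0 \<in> V" and "?T z0 + cvx_indicator ?C z0 \<noteq> \<infinity>"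
  then have "?T z0 \<noteq> \<infinity>" and C0: "z0 \<in> ?C"
    by (auto simp: cvx_indicator_def split: if_splits)
  then obtain c where c: "?T z0 = ereal c"
    using transport_cost_nonneg[of z0] by (cases "?T z0") auto
  \<comment> \<open>As \<open>z0\<close> minimizes the residual, being a minimizer means having
    residual at most that of \<open>z0\<close>.\<close>
  have C: "z \<in> ?C \<longleftrightarrow> z \<in> V \<and> ?r z \<le> ?r z0" for z
    using C0 unfolding constraint_set_def is_arg_min_linorder mem_Collect_eq by (meson order_trans)
  have "z0 \<in> sublevel c (?r z0)"
    using z0 c by (simp add: sublevel_def)
  then obtain z where z: "z \<in> sublevel c (?r z0)"
    "\<And>y. y \<in> sublevel c (?r z0) \<Longrightarrow> ?T z + ereal (0 * ?r z) \<le> ?T y + ereal (0 * ?r y)"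
    by (rule minimizer_on_sublevel[where lam = 0]) blast
  have "is_arg_min (\<lambda>z. ?T z + cvx_indicator ?C z) (\<lambda>z. z \<in> V) z"
    unfolding is_arg_min_linorder
  proof (intro conjI allI impI)
    show "z \<in> V"
      using z by (simp add: sublevel_def)
    fix y
    assume "y \<in> V"
    have zC: "z \<in> ?C" and zc: "?T z \<le> ereal c"
      using z by (auto simp: sublevel_def C)
    show "?T z + cvx_indicator ?C z \<le> ?T y + cvx_indicator ?C y"
    proof (cases "y \<in> ?C \<and> ?T y \<le> ereal c")
      case True
      then have "y \<in> sublevel c (?r z0)"
        by (simp add: sublevel_def C)
      then show ?thesis
        using z(2)[of y] zC True by (simp add: cvx_indicator_def flip: zero_ereal_def)
    next
      \<comment> \<open>Either the indicator makes the right-hand side infinite, or the cost of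
        \<open>y\<close> exceeds \<open>c\<close>, which bounds the cost of
        \<open>z\<close>.\<close>
      case False
      then show ?thesis
        using zC zc transport_cost_nonneg[of y] by (cases "?T y") (auto simp: cvx_indicator_def elim!: order_trans)
    qed
  qed
  then show "\<exists>z. is_arg_min (\<lambda>z. ?T z + cvx_indicator ?C z) (\<lambda>z. z \<in> V) z" ..
qed

lemma penalized_minimizer:
  assumes "0 < lam"
  shows "\<exists>z. is_arg_min
    (\<lambda>z. transport_cost p bc N P f0 f1 z + ereal (lam * continuity_residual bc N P f0 f1 z))
    (\<lambda>z. z \<in> V) z"
proof (rule exists_arg_min_if_not_infinite)
  let ?F = "\<lambda>z. transport_cost p bc N P f0 f1 z + ereal (lam * continuity_residual bc N P f0 f1 z)"
  have r: "0 \<le> continuity_residual bc N P f0 f1 z" if "z \<in> V" for z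
    using that by (simp add: continuity_residual_eq sum_nonneg)
  fix z0
  assume z0: "z0 \<in> V" and "?F z0 \<noteq> \<infinity>"
  then obtain c where c: "?F z0 = ereal c"
    using transport_cost_nonneg[of z0] by (cases "transport_cost p bc N P f0 f1 z0") auto
  \<comment> \<open>Both terms of the objective are nonnegative, so each is at most
    \<open>c\<close>; dividing the penalty by \<open>lam > 0\<close> gives the residual level
    \<open>c / lam\<close>.\<close>
  have sub: "y \<in> sublevel c (c / lam)" if y: "y \<in> V" "?F y \<le> ereal c" for y
  proof -
    obtain t where t: "transport_cost p bc N P f0 f1 y = ereal t"
      using y(2) transport_cost_nonneg[of y] by (cases "transport_cost p bc N P f0 f1 y") auto
    then have "0 \<le> t" "t + lam * continuity_residual bc N P f0 f1 y \<le> c"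
      using y(2) transport_cost_nonneg[of y] by auto
    moreover have "0 \<le> lam * continuity_residual bc N P f0 f1 y"
      using r[OF y(1)] assms by simp
    ultimately have "t \<le> c" "lam * continuity_residual bc N P f0 f1 y \<le> c"
      by linarith+
    then show ?thesis
      using y(1) t assms by (simp add: sublevel_def field_simps)
  qed
  have "z0 \<in> sublevel c (c / lam)"
    using z0 c by (intro sub) auto
  then obtain z where z: "z \<in> sublevel c (c / lam)" "\<And>y. y \<in> sublevel c (c / lam) \<Longrightarrow> ?F z \<le> ?F y"
    by (rule minimizer_on_sublevel[where lam = lam]) blast
  have "?F z \<le> ?F y" if "y \<in> V" for y
  proof (cases "?F y \<le> ereal c")
    case True
    then show ?thesis
      using that by (intro z(2) sub)
  next
    \<comment> \<open>Such a \<open>y\<close> is worse than \<open>z0\<close>, whose value is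
      \<open>c\<close>, and \<open>z\<close> is at least as good as \<open>z0\<close>.\<close>
    case False
    have "?F z \<le> ereal c"
      using z(2)[OF \<open>z0 \<in> sublevel c (c / lam)\<close>] c by simp
    with False show ?thesis
      by simp
  qed
  then show "\<exists>z. is_arg_min ?F (\<lambda>z. z \<in> V) z"
    unfolding is_arg_min_linorder using sublevel_subset[OF z(1)] by blast
qed

end

theorem proposition2:
  fixes p :: real and N P :: nat and f0 f1 :: "real vec" and bc :: boundary
  assumes "1 < p" and "p \<le> 2"
    and "N \<ge> 2" and "P \<ge> 2"
    and "f0 \<in> carrier_vec N" and "\<forall>i<N. 0 \<le> f0 $ i"
    and "f1 \<in> carrier_vec N" and "\<forall>i<N. 0 \<le> f1 $ i"
  shows "(\<exists>z. is_arg_min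
            (\<lambda>z. transport_cost p bc N P f0 f1 z + cvx_indicator (constraint_set bc N P f0 f1) z)
            (\<lambda>z. z \<in> var_space bc N P) z)
    \<and> (\<forall>lam::real. lam > 0 \<longrightarrow>
         (\<exists>z. is_arg_min
            (\<lambda>z. transport_cost p bc N P f0 f1 z + ereal (lam * continuity_residual bc N P f0 f1 z))
            (\<lambda>z. z \<in> var_space bc N P) z))"
proof -
  interpret transport_problem p bc N P f0 f1
    using assms by unfold_locales
  show ?thesis
    using constrained_minimizer penalized_minimizer by blast
qed

end
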